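(* For every integer $n\ge 0$ let $W_n$ be the $n$-twist link and $W_n(x)$ its generating polynomial (with $W_0$ the unknot, $W_0(x)=x$). Then $W_n(x)$ satisfies the recurrence $$W_n(x)=(2x^2+4x+2)\,W_{n-1}(x)\qquad (n\ge 1),$$ and is given by the closed form $$W_n(x)=x\left(2x^2+4x+2\right)^n\qquad (n\ge 0).$$
   Context: A knot (diagram) means a shadow on the sphere $S^2$: a finite collection of closed curves whose only singularities are finitely many transverse double points, called crossings, with no over/under information, considered up to planar isotopy (several components and crossingless circles are allowed). The unknot $U$ is a single simple closed curve. Each crossing can be split in two ways: remove the crossing and reconnect the four ends in one of the two planar non-crossing ways that join adjacent ends (type $0$ and type $1$ splits). A state of a knot $K$ with $m$ crossings is one of the $2^m$ diagrams obtained by choosing a split at each crossing; it is a disjoint union of simple closed curves (circles), and $|S|$ denotes the number of circles of the state $S$. The generating polynomial of $K$ is $K(x)=\sum_S x^{|S|}$, summed over all $2^m$ states. The connected sum $K\#K'$ of two knots is obtained by removing a small arc from each and joining the four endpoints by two new arcs without introducing new crossings. The $1$-twist link $W_1$ is the three-crossing shadow obtained by twisting the Hopf link: $W_1=L_1\#T_1$, where $L_1$ is the Hopf link shadow (two circles meeting in two crossings) and $T_1$ is the one-crossing figure-eight curve. The $n$-twist link $W_n$ is the connected sum of $n$ copies of $W_1$ in a row (the right end of each copy connected to the left end of the next), with $W_0=U$. *)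

theory Defs
  imports "HOL-Computational_Algebra.Polynomial"
begin

section \<open>Shadows on the sphere\<close>

text \<open>
  A shadow is given by its arcs (the pieces into which the crossings cut the curves) and its
  crossings. Arc \<open>a\<close> has the two ends \<open>(a, False)\<close> and \<open>(a, True)\<close>, and a crossing lists, in
  counterclockwise order, the four arc ends that meet there. This rotation system determines the
  embedding of a connected shadow in the sphere up to isotopy. An arc none of whose ends lies at a
  crossing is a crossingless circle: its two ends are understood to be joined to each other.
\<close>

type_synonym arc_end = "nat \<times> bool"

datatype 'e crossing = Crossing 'e 'e 'e 'e

datatype shadow = Shadow (arcs: "nat set") (crossings: "arc_end crossing list")

definition opp :: "arc_end \<Rightarrow> arc_end" where
  "opp e = (fst e, \<not> snd e)"

fun ends_at :: "'e crossing \<Rightarrow> 'e list" where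
  "ends_at (Crossing p q r s) = [p, q, r, s]"

definition crossing_ends :: "shadow \<Rightarrow> arc_end set" where
  "crossing_ends K = (\<Union>c\<in>set (crossings K). set (ends_at c))"

definition crossingless_circles :: "shadow \<Rightarrow> nat set" where
  "crossingless_circles K =
     {a \<in> arcs K. (a, False) \<notin> crossing_ends K \<and> (a, True) \<notin> crossing_ends K}"

text \<open>The classes of the equivalence relation on \<open>A\<close> generated by \<open>R\<close>.\<close>

definition classes :: "'b set \<Rightarrow> ('b \<times> 'b) set \<Rightarrow> 'b set set" where
  "classes A R = A // {(x, y) \<in> A \<times> A. (x, y) \<in> (R \<union> R\<inverse>)\<^sup>*}"

fun turn_at :: "'e crossing \<Rightarrow> ('e \<times> 'e) set" where
  "turn_at (Crossing p q r s) = {(p, q), (q, r), (r, s), (s, p)}"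

definition turn :: "shadow \<Rightarrow> (arc_end \<times> arc_end) set" where
  "turn K = (\<Union>c\<in>set (crossings K). turn_at c)"

text \<open>
  Following an arc to its other end and then turning to the neighbouring arc end at that crossing
  walks around a face.
\<close>

definition faces :: "shadow \<Rightarrow> arc_end set set" where
  "faces K = classes (crossing_ends K) {(x, y). (opp x, y) \<in> turn K}"

definition components :: "shadow \<Rightarrow> arc_end set set" where
  "components K = classes (crossing_ends K) (turn K \<union> {(x, opp x) | x. True})"

text \<open>
  Every arc end at a crossing occupies exactly one place, and Euler's formula (vertices plus faces
  equals edges plus two for each connected component) says that the surface is a sphere.
\<close>

definition is_shadow :: "shadow \<Rightarrow> bool" where
  "is_shadow K \<longleftrightarrow>
     finite (arcs K) \<and>
     distinct (concat (map ends_at (crossings K))) \<and>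
     crossing_ends K = (arcs K - crossingless_circles K) \<times> UNIV \<and>
     length (crossings K) + card (faces K) =
       card (arcs K - crossingless_circles K) + 2 * card (components K)"


section \<open>States and the generating polynomial\<close>

text \<open>
  A split reconnects adjacent ends; \<open>split_at t c\<close> records which arcs become joined. Which of
  the two splits is called type 0 at a crossing is immaterial, as both occur in the states.
\<close>

fun split_at :: "bool \<Rightarrow> arc_end crossing \<Rightarrow> (nat \<times> nat) set" where
  "split_at False (Crossing p q r s) = {(fst p, fst q), (fst r, fst s)}"
| "split_at True (Crossing p q r s) = {(fst q, fst r), (fst s, fst p)}"

definition states :: "shadow \<Rightarrow> bool list set" where
  "states K = {S. length S = length (crossings K)}"

text \<open>
  After splitting all crossings each arc end is joined to exactly one arc end, so the closed curves
  of the state are the classes of arcs connected through the joins.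
\<close>

definition state_circles :: "shadow \<Rightarrow> bool list \<Rightarrow> nat set set" where
  "state_circles K S = classes (arcs K) (\<Union>(t, c)\<in>set (zip S (crossings K)). split_at t c)"

definition gen_poly :: "shadow \<Rightarrow> int poly" where
  "gen_poly K = (\<Sum>S\<in>states K. [:0, 1:] ^ card (state_circles K S))"


section \<open>Connected sums\<close>

text \<open>
  Disjoint copies of the two shadows are obtained by renaming arc \<open>a\<close> to \<open>2 * a\<close> in the left and
  to \<open>2 * a + 1\<close> in the right shadow.
\<close>

definition in_left :: "arc_end \<Rightarrow> arc_end" where
  "in_left e = (2 * fst e, snd e)"

definition in_right :: "arc_end \<Rightarrow> arc_end" where
  "in_right e = (2 * fst e + 1, snd e)"

text \<open>
  \<open>connected_sum K d K' d'\<close> cuts the arc \<open>fst d\<close> of \<open>K\<close> and the arc \<open>fst d'\<close> of \<open>K'\<close>. The half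
  containing \<open>d\<close> is joined to the half containing \<open>d'\<close>, and the half containing \<open>opp d\<close> to the half
  containing \<open>opp d'\<close>; this amounts to exchanging \<open>opp d\<close> and \<open>d'\<close> in the disjoint union of the
  crossings. A crossingless circle that is cut leaves a single arc, so that summing with it merely
  deletes the circle.
\<close>

definition connected_sum :: "shadow \<Rightarrow> arc_end \<Rightarrow> shadow \<Rightarrow> arc_end \<Rightarrow> shadow" where
  "connected_sum K d K' d' =
    (let A = (\<lambda>a. 2 * a) ` arcs K;
         A' = (\<lambda>a. 2 * a + 1) ` arcs K';
         C = map (map_crossing in_left) (crossings K) @
             map (map_crossing in_right) (crossings K')
     in if fst d \<in> crossingless_circles K then Shadow (A - {2 * fst d} \<union> A') C
        else if fst d' \<in> crossingless_circles K' then Shadow (A \<union> (A' - {2 * fst d' + 1})) C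
        else Shadow (A \<union> A')
          (map (map_crossing (id(in_left (opp d) := in_right d', in_right d' := in_left (opp d)))) C))"

text \<open>
  A strip is a shadow with its left and right ends: the leftmost and the rightmost arc, each
  given by the arc end that lies above when the arc is cut in the middle.
\<close>

type_synonym strip = "shadow \<times> arc_end \<times> arc_end"

fun row_sum :: "strip \<Rightarrow> strip \<Rightarrow> strip" where
  "row_sum (K, l, r) (K', l', r') = (connected_sum K r K' l', in_left l, in_right r')"


section \<open>Twist links\<close>

definition unknot :: shadow where
  "unknot = Shadow {0} []"

text \<open>
  Two overlapping round circles side by side. Arcs 0 and 1 are the outer and the inner arc of the
  left circle, arcs 2 and 3 the inner and the outer arc of the right one; the end \<open>False\<close> of each
  arc is at the upper crossing. Crossings are listed from the north-east corner.
\<close>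

definition hopf_link :: strip where
  "hopf_link =
    (Shadow {0, 1, 2, 3}
      [Crossing (3, False) (0, False) (2, False) (1, False),
       Crossing (1, True) (2, True) (0, True) (3, True)],
     (0, False), (3, False))"

text \<open>
  A horizontal figure eight with left lobe 0 and right lobe 1; the end \<open>False\<close> of each lobe is the
  upper one.
\<close>

definition figure_eight :: strip where
  "figure_eight =
    (Shadow {0, 1} [Crossing (1, False) (0, False) (0, True) (1, True)], (0, False), (1, False))"

definition one_twist_link :: strip where
  "one_twist_link = row_sum hopf_link figure_eight"

text \<open>The row of \<open>n + 1\<close> copies of the 1-twist link.\<close>

fun twist_row :: "nat \<Rightarrow> strip" where
  "twist_row 0 = one_twist_link"
| "twist_row (Suc n) = row_sum (twist_row n) one_twist_link"

fun twist_link :: "nat \<Rightarrow> shadow" where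
  "twist_link 0 = unknot"
| "twist_link (Suc n) = fst (twist_row n)"


subsection \<open>The building blocks are shadows\<close>

lemma successively_rtrancl:
  assumes "successively (\<lambda>x y. (x, y) \<in> R) (x # xs)" "y \<in> set (x # xs)"
  shows "(x, y) \<in> R\<^sup>*"
  using assms
proof (induction xs arbitrary: x)
  case (Cons z zs)
  then show ?case by (auto intro: converse_rtrancl_into_rtrancl)
qed simp

lemma classes_eqI:
  assumes A: "A = \<Union>(set ` set P)" and "[] \<notin> set P"
    and closed: "\<And>X x y. X \<in> set P \<Longrightarrow> (x, y) \<in> R \<Longrightarrow> x \<in> set X \<longleftrightarrow> y \<in> set X"
    and conn: "\<And>X. X \<in> set P \<Longrightarrow> successively (\<lambda>x y. (x, y) \<in> R) X"
  shows "classes A R = set ` set P"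
proof -
  let ?S = "(R \<union> R\<inverse>)\<^sup>*"
  let ?E = "{(x, y) \<in> A \<times> A. (x, y) \<in> ?S}"
  have "sym ?S" by (simp add: sym_Un_converse sym_rtrancl)
  have mono: "(x, y) \<in> R\<^sup>* \<Longrightarrow> (x, y) \<in> ?S" for x y
    using rtrancl_mono[of R "R \<union> R\<inverse>"] by auto
  have cl: "x \<in> set X \<longleftrightarrow> y \<in> set X" if "(x, y) \<in> ?S" "X \<in> set P" for x y X
    using that by (induction) (auto simp: closed)
  have img: "?E `` {x} = set X" if "X \<in> set P" "x \<in> set X" for x X
  proof -
    obtain r X' where X: "X = r # X'" using \<open>x \<in> set X\<close> by (cases X) auto
    have r: "(r, y) \<in> ?S" if "y \<in> set X" for y
      using successively_rtrancl[of R r X' y] conn[OF \<open>X \<in> set P\<close>] that mono X by blast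
    have "(x, y) \<in> ?S" if "y \<in> set X" for y
      using r[OF that] r[OF \<open>x \<in> set X\<close>] \<open>sym ?S\<close> by (meson rtrancl_trans symD)
    then show ?thesis using that A cl by auto
  qed
  have "classes A R = (\<lambda>x. ?E `` {x}) ` A"
    by (auto simp: classes_def quotient_def)
  also have "\<dots> = set ` set P"
  proof (intro equalityI subsetI)
    fix X assume "X \<in> (\<lambda>x. ?E `` {x}) ` A"
    then obtain x Y where "X = ?E `` {x}" "Y \<in> set P" "x \<in> set Y"
      unfolding A by blast
    then show "X \<in> set ` set P" using img by blast
  next
    fix X assume "X \<in> set ` set P"
    then obtain Y where Y: "Y \<in> set P" "X = set Y" by blast
    with assms(2) obtain x where "x \<in> set Y" by (metis last_in_set)
    with Y show "X \<in> (\<lambda>x. ?E `` {x}) ` A"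
      using img A by blast
  qed
  finally show ?thesis .
qed

lemma walk_image: "{(x, y). (opp x, y) \<in> T} = (\<lambda>(x, y). (opp x, y)) ` T"
proof (intro equalityI subsetI)
  fix e assume "e \<in> {(x, y). (opp x, y) \<in> T}"
  then obtain x y where "e = (x, y)" "(opp x, y) \<in> T" by blast
  moreover have "x = opp (opp x)" by (simp add: opp_def)
  ultimately show "e \<in> (\<lambda>(x, y). (opp x, y)) ` T"
    by (metis (no_types, lifting) case_prod_conv image_eqI)
qed (auto simp: opp_def)

lemma is_shadow_unknot: "is_shadow unknot"
  by (simp add: is_shadow_def unknot_def crossingless_circles_def crossing_ends_def
      faces_def components_def classes_def)

lemma is_shadow_figure_eight: "is_shadow (fst figure_eight)"
proof -
  let ?K = "fst figure_eight"
  let ?a = "(0::nat, False)" let ?A = "(0::nat, True)"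
  let ?b = "(1::nat, False)" let ?B = "(1::nat, True)"
  have ends: "crossing_ends ?K = {?b, ?a, ?A, ?B}"
    by (simp add: crossing_ends_def figure_eight_def)
  have circ: "crossingless_circles ?K = {}"
    unfolding crossingless_circles_def ends by (auto simp: figure_eight_def)
  have turn: "turn ?K = {(?b, ?a), (?a, ?A), (?A, ?B), (?B, ?b)}"
    by (auto simp: turn_def figure_eight_def)
  have walk: "{(x, y). (opp x, y) \<in> turn ?K} = {(?B, ?a), (?A, ?A), (?a, ?B), (?b, ?b)}"
    unfolding turn walk_image by (simp add: opp_def insert_commute)
  have f: "faces ?K = set ` set [[?a, ?B], [?A], [?b]]"
    unfolding faces_def walk ends by (rule classes_eqI) auto
  have c: "components ?K = set ` set [[?b, ?a, ?A, ?B]]"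
    unfolding components_def turn ends
    by (rule classes_eqI) (auto simp: opp_def)
  show ?thesis
    unfolding is_shadow_def f c circ ends
    by (auto simp: figure_eight_def)
qed

lemma is_shadow_hopf_link: "is_shadow (fst hopf_link)"
proof -
  let ?K = "fst hopf_link"
  let ?a = "(0::nat, False)" let ?A = "(0::nat, True)"
  let ?b = "(1::nat, False)" let ?B = "(1::nat, True)"
  let ?c = "(2::nat, False)" let ?C = "(2::nat, True)"
  let ?d = "(3::nat, False)" let ?D = "(3::nat, True)"
  have ends: "crossing_ends ?K = {?d, ?a, ?c, ?b, ?B, ?C, ?A, ?D}"
    by (simp add: crossing_ends_def hopf_link_def insert_commute)
  have circ: "crossingless_circles ?K = {}"
    unfolding crossingless_circles_def ends by (auto simp: hopf_link_def)
  have turn: "turn ?K = {(?d, ?a), (?a, ?c), (?c, ?b), (?b, ?d)} \<union>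
      {(?B, ?C), (?C, ?A), (?A, ?D), (?D, ?B)}"
    by (simp add: turn_def hopf_link_def Un_commute)
  have walk: "{(x, y). (opp x, y) \<in> turn ?K} =
     {(?D, ?a), (?A, ?c), (?C, ?b), (?B, ?d), (?b, ?C), (?c, ?A), (?a, ?D), (?d, ?B)}"
    unfolding turn walk_image by (simp add: opp_def insert_commute)
  have f: "faces ?K = set ` set [[?a, ?D], [?c, ?A], [?b, ?C], [?d, ?B]]"
    unfolding faces_def walk ends by (rule classes_eqI) auto
  have c: "components ?K = set ` set [[?d, ?a, ?c, ?b, ?B, ?C, ?A, ?D]]"
    unfolding components_def turn ends
    by (rule classes_eqI) (auto simp: opp_def)
  have "card (faces ?K) = 4"
    unfolding f by (simp add: doubleton_eq_iff)
  then show ?thesis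
    unfolding is_shadow_def c circ ends
    by (auto simp: hopf_link_def)
qed

end

theory Submission
  imports Defs
begin

text \<open>
  The generating polynomial is multiplicative under connected sums up to one factor \<open>x\<close>:
  \<open>x * (K # K')(x) = K(x) * K'(x)\<close> (\<open>gen_poly_connected_sum\<close>). Indeed, a state of the sum is a pair
  of states of the summands, and its circles are those of the two states, except that the circle
  through the cut arc of \<open>K\<close> and the circle through the cut arc of \<open>K'\<close> have been merged into one
  (\<open>card_state_circles_connected_sum\<close>). The polynomials of the Hopf link and of the figure eight are
  \<open>2 * x^2 + 2 * x\<close> and \<open>x^2 + x\<close>, so the 1-twist link has \<open>x * (2 * x^2 + 4 * x + 2)\<close>, each further
  copy contributes the factor \<open>2 * x^2 + 4 * x + 2\<close>, and induction along the row gives the closed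
  form. The recurrence is read off from it.

  The merging of the two circles is where geometry enters. The connected sum exchanges one end of
  the arc of \<open>K\<close> with one end of the arc of \<open>K'\<close>. That this joins two circles, rather
  than leaving them apart, rests on the fact that a circle cut at one arc is still in one piece:
  otherwise one of the pieces would have a single loose end, while splitting the crossings joins
  the ends in pairs. This parity argument is \<open>cut_arc_halves_connected\<close>. Given it, the arcs connected
  in the state of the sum are those connected by the joins of the two separate states together
  with one bridge between the two cut arcs, and a bridge lowers the number of classes by one
  (\<open>card_classes_bridge\<close>).
\<close>

section \<open>Classes of a generated equivalence\<close>

definition eqcl :: "('b \<times> 'b) set \<Rightarrow> ('b \<times> 'b) set" where
  "eqcl R = (R \<union> R\<inverse>)\<^sup>*"

lemma eqcl_refl [simp]: "(x, x) \<in> eqcl R"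
  by (simp add: eqcl_def)

lemma eqcl_base: "(x, y) \<in> R \<Longrightarrow> (x, y) \<in> eqcl R"
  by (auto simp: eqcl_def)

lemma eqcl_sym: "(x, y) \<in> eqcl R \<Longrightarrow> (y, x) \<in> eqcl R"
  unfolding eqcl_def by (rule symD[OF sym_rtrancl[OF sym_Un_converse]])

lemma eqcl_trans: "(x, y) \<in> eqcl R \<Longrightarrow> (y, z) \<in> eqcl R \<Longrightarrow> (x, z) \<in> eqcl R"
  unfolding eqcl_def by (rule rtrancl_trans)

lemma eqcl_cong: "(x, y) \<in> eqcl R \<Longrightarrow> (x, z) \<in> eqcl R \<longleftrightarrow> (y, z) \<in> eqcl R"
  using eqcl_trans[of x y R z] eqcl_trans[of y x R z] eqcl_sym[of x y R] by blast

lemma eqcl_least: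
  assumes "R \<subseteq> eqcl T"
  shows "eqcl R \<subseteq> eqcl T"
proof -
  have "R \<union> R\<inverse> \<subseteq> eqcl T"
    using assms eqcl_sym by fast
  then have "eqcl R \<subseteq> (eqcl T)\<^sup>*"
    unfolding eqcl_def by (rule rtrancl_mono)
  then show ?thesis by (simp add: eqcl_def)
qed

lemma eqcl_mono: "R \<subseteq> T \<Longrightarrow> eqcl R \<subseteq> eqcl T"
  by (rule eqcl_least) (auto intro: eqcl_base)

lemma eqcl_eqI: "R \<subseteq> eqcl T \<Longrightarrow> T \<subseteq> eqcl R \<Longrightarrow> eqcl R = eqcl T"
  by (intro equalityI eqcl_least)

lemma eqcl_closed:
  assumes "(x, y) \<in> eqcl R" and "\<And>x y. (x, y) \<in> R \<Longrightarrow> x \<in> X \<longleftrightarrow> y \<in> X"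
  shows "x \<in> X \<longleftrightarrow> y \<in> X"
  using assms(1) unfolding eqcl_def by induction (use assms(2) in blast)+

lemma eqcl_image:
  assumes "(x, y) \<in> eqcl R"
  shows "(h x, h y) \<in> eqcl (map_prod h h ` R)"
  using assms unfolding eqcl_def
proof induction
  case (step y z)
  then have "(h y, h z) \<in> map_prod h h ` R \<union> (map_prod h h ` R)\<inverse>"
    by force
  with step.IH show ?case
    by (rule rtrancl_into_rtrancl)
qed simp

lemma classes_eqcl: "classes A R = (\<lambda>x. {y \<in> A. (x, y) \<in> eqcl R}) ` A"
  by (auto simp: classes_def eqcl_def quotient_def)

lemma classes_cong: "eqcl R = eqcl T \<Longrightarrow> classes A R = classes A T"
  by (simp add: classes_eqcl)

text \<open>
  Classes are computed by exhibiting the partition. Unlike in \<open>classes_eqI\<close>, the blocks are arbitrary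
  sets and need not be traversed along the direction of \<open>R\<close>.
\<close>

lemma classes_eq_partitionI:
  assumes A: "\<Union>P = A" and ne: "{} \<notin> P"
    and closed: "\<And>X x y. X \<in> P \<Longrightarrow> (x, y) \<in> R \<Longrightarrow> x \<in> X \<longleftrightarrow> y \<in> X"
    and conn: "\<And>X x y. X \<in> P \<Longrightarrow> x \<in> X \<Longrightarrow> y \<in> X \<Longrightarrow> (x, y) \<in> eqcl R"
  shows "classes A R = P"
proof -
  have cl: "{y \<in> A. (x, y) \<in> eqcl R} = X" if "X \<in> P" "x \<in> X" for x X
    using eqcl_closed[of x _ R X] closed[OF that(1)] conn[OF that(1)] that A by blast
  have "P \<subseteq> classes A R"
  proof
    fix X assume "X \<in> P"
    moreover then obtain x where "x \<in> X" using ne by (metis all_not_in_conv)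
    ultimately show "X \<in> classes A R"
      using cl A unfolding classes_eqcl by blast
  qed
  moreover have "classes A R \<subseteq> P"
    unfolding classes_eqcl using cl A by auto
  ultimately show ?thesis by blast
qed

lemma classes_singletonI:
  assumes "a \<in> A" "R \<subseteq> A \<times> A" "\<And>x. x \<in> A \<Longrightarrow> (a, x) \<in> eqcl R"
  shows "classes A R = {A}"
proof (rule classes_eq_partitionI)
  show "(x, y) \<in> eqcl R" if "X \<in> {A}" "x \<in> X" "y \<in> X" for X x y
    using that assms(3) eqcl_sym eqcl_trans by (metis singletonD)
qed (use assms in auto)

lemma Union_classes: "\<Union>(classes A R) = A"
  by (auto simp: classes_eqcl)

lemma empty_notin_classes: "{} \<notin> classes A R"
  by (auto simp: classes_eqcl)

lemma class_subset: "X \<in> classes A R \<Longrightarrow> X \<subseteq> A"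
  by (auto simp: classes_eqcl)

lemma class_of_member:
  assumes "X \<in> classes A R" "x \<in> X"
  shows "X = {y \<in> A. (x, y) \<in> eqcl R}"
proof -
  obtain z where z: "X = {y \<in> A. (z, y) \<in> eqcl R}"
    using assms(1) unfolding classes_eqcl by blast
  then have "(z, x) \<in> eqcl R" using assms(2) by simp
  then show ?thesis unfolding z using eqcl_cong[of z x R] by blast
qed

lemma classes_connected: "X \<in> classes A R \<Longrightarrow> x \<in> X \<Longrightarrow> y \<in> X \<Longrightarrow> (x, y) \<in> eqcl R"
  using class_of_member by fast

lemma classes_closed:
  assumes "R \<subseteq> A \<times> A" "X \<in> classes A R" "(x, y) \<in> R"
  shows "x \<in> X \<longleftrightarrow> y \<in> X"
proof -
  have "x \<in> A" "y \<in> A" "(x, y) \<in> eqcl R" "(y, x) \<in> eqcl R"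
    using assms by (auto intro: eqcl_base eqcl_sym)
  then show ?thesis using class_of_member[OF assms(2)] by blast
qed

lemma classes_disjoint:
  assumes "X \<in> classes A R" "Y \<in> classes A R" "x \<in> X" "x \<in> Y"
  shows "X = Y"
  using class_of_member[of X A R x] class_of_member[of Y A R x] assms by simp

lemma finite_classes: "finite A \<Longrightarrow> finite (classes A R)"
  by (simp add: classes_eqcl)

lemma card_classes_image:
  assumes "inj_on h A" "R \<subseteq> A \<times> A"
  shows "card (classes (h ` A) (map_prod h h ` R)) = card (classes A R)"
proof -
  note sub = class_subset[of _ A R]
  have "classes (h ` A) (map_prod h h ` R) = (`) h ` classes A R"
  proof (rule classes_eq_partitionI)
    show "\<Union> ((`) h ` classes A R) = h ` A"
      by (metis Union_classes image_Union)
    show "{} \<notin> (`) h ` classes A R"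
      using empty_notin_classes[of A R] by auto
  next
    fix X u v assume X: "X \<in> (`) h ` classes A R" and uv: "(u, v) \<in> map_prod h h ` R"
    obtain Y where Y: "Y \<in> classes A R" "X = h ` Y" using X by blast
    obtain x y where xy: "(x, y) \<in> R" "u = h x" "v = h y" using uv by auto
    have "x \<in> A" "y \<in> A" using xy assms by auto
    then have "u \<in> X \<longleftrightarrow> x \<in> Y" "v \<in> X \<longleftrightarrow> y \<in> Y"
      using Y xy sub[OF Y(1)] assms(1) by (auto simp: inj_on_image_mem_iff)
    then show "u \<in> X \<longleftrightarrow> v \<in> X"
      using classes_closed[OF assms(2) Y(1) xy(1)] by simp
  next
    fix X u v assume "X \<in> (`) h ` classes A R" "u \<in> X" "v \<in> X"
    then show "(u, v) \<in> eqcl (map_prod h h ` R)"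
      by (auto intro: eqcl_image classes_connected)
  qed
  moreover have "inj_on ((`) h) (classes A R)"
    using sub assms(1) by (auto simp: inj_on_def inj_on_image_eq_iff)
  ultimately show ?thesis
    by (simp add: card_image)
qed

text \<open>
  The bridge from \<open>a\<close> to \<open>b\<close> fuses the class of \<open>a\<close> with the class of \<open>b\<close> and leaves all others as they
  are.
\<close>

lemma card_classes_bridge:
  assumes fin: "finite A" "finite B" and disj: "A \<inter> B = {}"
    and R: "R \<subseteq> A \<times> A" and T: "T \<subseteq> B \<times> B" and ab: "a \<in> A" "b \<in> B"
  shows "Suc (card (classes (A \<union> B) (R \<union> T \<union> {(a, b)}))) = card (classes A R) + card (classes B T)"
proof -
  let ?U = "R \<union> T \<union> {(a, b)}"
  obtain X where X: "X \<in> classes A R" "a \<in> X" using ab(1) Union_classes[of A R] by blast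
  obtain Y where Y: "Y \<in> classes B T" "b \<in> Y" using ab(2) Union_classes[of B T] by blast
  let ?P = "classes A R - {X}" and ?Q = "classes B T - {Y}"
  note subA = class_subset[of _ A R] and subB = class_subset[of _ B T]
  have aZ: "a \<notin> Z" if "Z \<in> ?P" for Z using that X classes_disjoint[of Z A R X a] by blast
  have bZ: "b \<notin> Z" if "Z \<in> ?Q" for Z using that Y classes_disjoint[of Z B T Y b] by blast
  have UR: "eqcl R \<subseteq> eqcl ?U" and UT: "eqcl T \<subseteq> eqcl ?U"
    by (auto intro!: eqcl_mono)
  have Uab: "(a, b) \<in> eqcl ?U" by (simp add: eqcl_base)
  have "classes (A \<union> B) ?U = insert (X \<union> Y) (?P \<union> ?Q)"
  proof (rule classes_eq_partitionI)
    have "\<Union>(insert X ?P) = A" "\<Union>(insert Y ?Q) = B"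
      using X Y by (simp_all add: insert_absorb Union_classes)
    then show "\<Union>(insert (X \<union> Y) (?P \<union> ?Q)) = A \<union> B" by auto
    show "{} \<notin> insert (X \<union> Y) (?P \<union> ?Q)"
      using X empty_notin_classes[of A R] empty_notin_classes[of B T] by auto
  next
    fix Z x y assume Z: "Z \<in> insert (X \<union> Y) (?P \<union> ?Q)" and xy: "(x, y) \<in> ?U"
    have A: "x \<in> Z' \<longleftrightarrow> y \<in> Z'" if "Z' \<in> classes A R" "(x, y) \<in> R \<union> T" for Z'
      using that classes_closed[OF R that(1), of x y] T subA[OF that(1)] disj by blast
    have B: "x \<in> Z' \<longleftrightarrow> y \<in> Z'" if "Z' \<in> classes B T" "(x, y) \<in> R \<union> T" for Z'
      using that classes_closed[OF T that(1), of x y] R subB[OF that(1)] disj by blast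
    show "x \<in> Z \<longleftrightarrow> y \<in> Z"
    proof (cases "(x, y) \<in> R \<union> T")
      case True
      then show ?thesis using Z A B X(1) Y(1) by blast
    next
      case False
      then have "x = a" "y = b" using xy by auto
      then show ?thesis
        using Z aZ bZ X Y subA subB ab disj by blast
    qed
  next
    fix Z x y assume Z: "Z \<in> insert (X \<union> Y) (?P \<union> ?Q)" and x: "x \<in> Z" and y: "y \<in> Z"
    show "(x, y) \<in> eqcl ?U"
    proof (cases "Z = X \<union> Y")
      case True
      have a: "(a, z) \<in> eqcl ?U" if "z \<in> Z" for z
        using that True classes_connected[OF X(1,2), of z] classes_connected[OF Y(1,2), of z]
          UR UT eqcl_trans[OF Uab, of z] by blast
      show ?thesis using a[OF x] a[OF y] eqcl_sym eqcl_trans by metis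
    next
      case False
      then show ?thesis
        using Z x y UR UT classes_connected[of Z A R x y] classes_connected[of Z B T x y] by blast
    qed
  qed
  moreover have "X \<union> Y \<notin> ?P \<union> ?Q" using aZ bZ X Y by blast
  moreover have "?P \<inter> ?Q = {}"
  proof -
    have "Z = {}" if "Z \<in> ?P" "Z \<in> ?Q" for Z
      using that subA[of Z] subB[of Z] disj by blast
    then show ?thesis using empty_notin_classes[of A R] by blast
  qed
  ultimately have "card (classes (A \<union> B) ?U) = Suc (card ?P + card ?Q)"
    using fin by (simp add: finite_classes card_Un_disjoint)
  moreover have "Suc (card ?P) = card (classes A R)" "Suc (card ?Q) = card (classes B T)"
    using X Y fin by (metis card.remove finite_classes)+
  ultimately show ?thesis by simp
qed


section \<open>Joining the ends at split crossings\<close>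

text \<open>
  Splitting joins arc ends, of which \<open>split_at\<close> only remembers the arcs. Keeping the ends
  makes it possible to say that every end is joined exactly once, and to compare states of shadows that
  differ in how the ends are assigned to arcs: such an assignment is the labelling \<open>g\<close> in \<open>joins\<close>.
\<close>

fun joined_ends :: "bool \<Rightarrow> 'e crossing \<Rightarrow> ('e \<times> 'e) set" where
  "joined_ends False (Crossing p q r s) = {(p, q), (r, s)}"
| "joined_ends True (Crossing p q r s) = {(q, r), (s, p)}"

definition joins :: "('e \<Rightarrow> 'b) \<Rightarrow> bool list \<Rightarrow> 'e crossing list \<Rightarrow> ('b \<times> 'b) set" where
  "joins g S cs = (\<Union>(t, c)\<in>set (zip S cs). map_prod g g ` joined_ends t c)"

abbreviation all_ends :: "'e crossing list \<Rightarrow> 'e list" where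
  "all_ends cs \<equiv> concat (map ends_at cs)"

lemma split_at_joined_ends: "split_at t c = map_prod fst fst ` joined_ends t c"
  by (cases t; cases c) auto

lemma state_circles_joins: "state_circles K S = classes (arcs K) (joins fst S (crossings K))"
  by (simp add: state_circles_def joins_def split_at_joined_ends)

lemma joined_ends_map:
  "map_prod g g ` joined_ends t (map_crossing h c) = map_prod (g \<circ> h) (g \<circ> h) ` joined_ends t c"
  by (cases t; cases c) auto

lemma joins_map: "joins g S (map (map_crossing h) cs) = joins (g \<circ> h) S cs"
  unfolding joins_def zip_map2 set_map UN_simps image_image case_prod_unfold
  by (simp add: joined_ends_map)

lemma joins_append:
  "length S = length cs \<Longrightarrow> joins g (S @ S') (cs @ cs') = joins g S cs \<union> joins g S' cs'"
  by (simp add: joins_def)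

lemma joins_image: "map_prod h h ` joins g S cs = joins (h \<circ> g) S cs"
  unfolding joins_def image_UN case_prod_unfold image_image
  by (simp add: map_prod.compositionality)

lemma joined_ends_subset: "joined_ends t c \<subseteq> set (ends_at c) \<times> set (ends_at c)"
  by (cases t; cases c) auto

lemma joinsE:
  assumes "(u, v) \<in> joins g S cs"
  obtains x y where "u = g x" "v = g y" "(x, y) \<in> joins id S cs"
    "x \<in> set (all_ends cs)" "y \<in> set (all_ends cs)"
proof -
  obtain t c x y where *: "(t, c) \<in> set (zip S cs)" "(x, y) \<in> joined_ends t c" "u = g x" "v = g y"
    using assms by (auto simp: joins_def)
  moreover have "(x, y) \<in> joins id S cs" using * by (force simp: joins_def map_prod.id)
  moreover have "c \<in> set cs" using * by (meson set_zip_rightD)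
  ultimately show thesis using that joined_ends_subset[of t c] by fastforce
qed

lemma joinsI: "(x, y) \<in> joins id S cs \<Longrightarrow> (g x, g y) \<in> joins g S cs"
  by (force simp: joins_def map_prod.id)

text \<open>
  Moving an end from one arc to another does not change what is connected if the two arcs
  are connected already.
\<close>

lemma joins_relabel:
  assumes "joins g S cs \<subseteq> eqcl T" and "\<And>x. x \<in> set (all_ends cs) \<Longrightarrow> (g x, h x) \<in> eqcl T"
  shows "joins h S cs \<subseteq> eqcl T"
proof clarify
  fix u v assume "(u, v) \<in> joins h S cs"
  then obtain x y where xy: "u = h x" "v = h y" "(x, y) \<in> joins id S cs"
    "x \<in> set (all_ends cs)" "y \<in> set (all_ends cs)" by (rule joinsE)
  have "(g x, g y) \<in> eqcl T" using assms(1) joinsI[OF xy(3)] by blast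
  then show "(u, v) \<in> eqcl T"
    using assms(2)[OF xy(4)] assms(2)[OF xy(5)] xy by (metis eqcl_sym eqcl_trans)
qed

text \<open>
  Each crossing joins its four ends in two pairs, and both ends of a pair satisfy \<open>Q\<close> or neither does.
  As no end occurs twice, the contributions of the crossings add up.
\<close>

lemma even_ends_of_union_of_circles:
  assumes "length S = length cs" "distinct (all_ends cs)"
    and "\<And>x y. (x, y) \<in> joins id S cs \<Longrightarrow> Q x \<longleftrightarrow> Q y"
  shows "even (card {x \<in> set (all_ends cs). Q x})"
proof -
  have "even (length (filter Q (all_ends cs)))"
    using assms(1,3)
  proof (induction S cs rule: list_induct2)
    case (Cons t S c cs)
    have "even (length (filter Q (ends_at c)))"
      using Cons.prems by (cases t; cases c) (auto simp: joins_def)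
    moreover have "even (length (filter Q (all_ends cs)))"
      using Cons.IH Cons.prems by (auto simp: joins_def)
    ultimately show ?case by simp
  qed simp
  moreover have "card {x \<in> set (all_ends cs). Q x} = length (filter Q (all_ends cs))"
    using assms(2) by (metis distinct_card distinct_filter set_filter)
  ultimately show ?thesis by simp
qed

text \<open>
  Let the end \<open>d\<close> be detached from its arc and made a vertex \<open>b\<close> of its own. If the piece containing \<open>b\<close>
  did not reach the rest of the arc, then its ends would be \<open>d\<close> and both ends of each of its arcs,
  an odd number in all. The labelling \<open>f\<close> of the arcs allows them to be renamed, so that \<open>b\<close> can be an
  arc of another shadow.
\<close>

lemma cut_arc_halves_connected:
  fixes d :: arc_end
  assumes len: "length S = length cs" and dist: "distinct (all_ends cs)"
    and ends: "set (all_ends cs) = B \<times> UNIV" and d: "d \<in> B \<times> UNIV"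
    and g: "g = (\<lambda>x. if x = d then b else f (fst x))"
  shows "(b, f (fst d)) \<in> eqcl (joins g S cs)"
proof (rule ccontr)
  assume not: "(b, f (fst d)) \<notin> eqcl (joins g S cs)"
  let ?Q = "\<lambda>x. (b, g x) \<in> eqcl (joins g S cs)"
  let ?D = "{v \<in> B. (b, f v) \<in> eqcl (joins g S cs)}"
  have "even (card {x \<in> set (all_ends cs). ?Q x})"
    using len dist by (rule even_ends_of_union_of_circles)
      (meson joinsI eqcl_base eqcl_sym eqcl_trans)
  also have "{x \<in> set (all_ends cs). ?Q x} = insert d (?D \<times> UNIV)"
    using d not unfolding ends g by auto
  finally have ev: "even (card (insert d (?D \<times> UNIV)))" .
  have "finite (B \<times> (UNIV :: bool set))" using ends by (metis List.finite_set)
  then have "finite B" by (auto simp: finite_cartesian_product_iff)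
  then have "finite (?D \<times> (UNIV :: bool set))" by simp
  moreover have "d \<notin> ?D \<times> UNIV" using not by auto
  ultimately show False using ev by (simp add: card_cartesian_product)
qed


section \<open>The generating polynomial of a connected sum\<close>

text \<open>
  The part of \<open>is_shadow\<close> that makes every state a collection of closed curves, stated so that it
  visibly passes to connected sums.
\<close>

definition closed_up :: "shadow \<Rightarrow> bool" where
  "closed_up K \<longleftrightarrow> finite (arcs K) \<and> distinct (all_ends (crossings K)) \<and>
     (\<forall>e\<in>crossing_ends K. fst e \<in> arcs K \<and> opp e \<in> crossing_ends K)"

lemma is_shadow_closed_up: "is_shadow K \<Longrightarrow> closed_up K"
  by (auto simp: is_shadow_def closed_up_def opp_def)

lemma crossing_ends_all_ends: "crossing_ends K = set (all_ends (crossings K))"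
  by (simp add: crossing_ends_def)

lemma closed_up_crossing_ends:
  assumes "closed_up K"
  shows "crossing_ends K = fst ` crossing_ends K \<times> UNIV"
proof -
  have "(a, t) \<in> crossing_ends K" if "(a, t') \<in> crossing_ends K" for a t t'
    using assms that by (cases "t = t'") (force simp: closed_up_def opp_def)+
  then show ?thesis by force
qed

lemma joins_subset_arcs:
  assumes "closed_up K"
  shows "joins fst S (crossings K) \<subseteq> arcs K \<times> arcs K"
proof clarify
  fix u v assume "(u, v) \<in> joins fst S (crossings K)"
  then obtain x y where "u = fst x" "v = fst y" "x \<in> crossing_ends K" "y \<in> crossing_ends K"
    unfolding crossing_ends_all_ends by (rule joinsE)
  then show "u \<in> arcs K \<and> v \<in> arcs K" using assms by (simp add: closed_up_def)
qed

definition exchange :: "arc_end \<Rightarrow> arc_end \<Rightarrow> arc_end \<Rightarrow> arc_end" where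
  "exchange d d' = id(in_left (opp d) := in_right d', in_right d' := in_left (opp d))"

lemma in_left_eq_iff [simp]: "in_left x = in_left y \<longleftrightarrow> x = y"
  by (auto simp: in_left_def prod_eq_iff)

lemma in_right_eq_iff [simp]: "in_right x = in_right y \<longleftrightarrow> x = y"
  by (auto simp: in_right_def prod_eq_iff)

lemma in_left_neq_in_right [simp]: "in_left x \<noteq> in_right y" "in_right y \<noteq> in_left x"
  by (auto simp: in_left_def in_right_def prod_eq_iff) presburger+

lemma opp_in_left: "opp (in_left x) = in_left (opp x)"
  by (simp add: in_left_def opp_def)

lemma opp_in_right: "opp (in_right x) = in_right (opp x)"
  by (simp add: in_right_def opp_def)

text \<open>When neither cut arc is a crossingless circle, the sum is formed by \<open>exchange\<close> alone.\<close>

lemma connected_sum_at_crossings: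
  assumes "d \<in> crossing_ends K" "d' \<in> crossing_ends K'"
  shows "connected_sum K d K' d' =
    Shadow ((\<lambda>a. 2 * a) ` arcs K \<union> (\<lambda>a. 2 * a + 1) ` arcs K')
      (map (map_crossing (exchange d d' \<circ> in_left)) (crossings K) @
       map (map_crossing (exchange d d' \<circ> in_right)) (crossings K'))"
proof -
  have "fst d \<notin> crossingless_circles K" "fst d' \<notin> crossingless_circles K'"
    using assms by (cases d; cases d'; cases "snd d"; cases "snd d'";
        auto simp: crossingless_circles_def)+
  then show ?thesis
    by (simp add: connected_sum_def exchange_def crossing.map_comp)
qed

lemma all_ends_map: "all_ends (map (map_crossing h) cs) = map h (all_ends cs)"
proof (induction cs)
  case (Cons c cs)
  then show ?case by (cases c) simp
qed simp

lemma exchange_image: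
  assumes "in_left (opp d) \<in> E" "in_right d' \<in> E"
  shows "exchange d d' ` E = E"
proof
  show "E \<subseteq> exchange d d' ` E"
  proof
    fix x assume x: "x \<in> E"
    have "exchange d d' (exchange d d' x) = x" by (auto simp: exchange_def)
    moreover have "exchange d d' x \<in> E" using x assms by (auto simp: exchange_def)
    ultimately show "x \<in> exchange d d' ` E" by (metis imageI)
  qed
qed (use assms in \<open>auto simp: exchange_def\<close>)

lemma
  assumes K: "closed_up K" "d \<in> crossing_ends K" and K': "closed_up K'" "d' \<in> crossing_ends K'"
  shows crossing_ends_connected_sum:
      "crossing_ends (connected_sum K d K' d') =
        in_left ` crossing_ends K \<union> in_right ` crossing_ends K'" (is ?ends)
    and closed_up_connected_sum: "closed_up (connected_sum K d K' d')" (is ?closed)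
proof -
  let ?x = "exchange d d'"
  note sum = connected_sum_at_crossings[OF K(2) K'(2)]
  have opp_d: "opp d \<in> crossing_ends K" using K by (auto simp: closed_up_def)
  have "crossing_ends (connected_sum K d K' d') =
      ?x ` (in_left ` crossing_ends K \<union> in_right ` crossing_ends K')"
    unfolding crossing_ends_all_ends sum
    by (simp only: shadow.sel map_append concat_append all_ends_map set_append set_map image_Un image_comp)
  also have "\<dots> = in_left ` crossing_ends K \<union> in_right ` crossing_ends K'"
    using opp_d K'(2) by (intro exchange_image) auto
  finally show ?ends .
  have "inj ?x" by (rule inj_on_inverseI[where g = ?x]) (auto simp: exchange_def)
  then have "inj (?x \<circ> in_left)" "inj (?x \<circ> in_right)"
    by (auto intro!: inj_compose simp: inj_def[of in_left] inj_def[of in_right])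
  moreover have "(?x \<circ> in_left) ` X \<inter> (?x \<circ> in_right) ` Y = {}" for X Y
  proof -
    have "in_left ` X \<inter> in_right ` Y = {}" by auto
    then show ?thesis unfolding image_comp[symmetric] image_Int[OF \<open>inj ?x\<close>, symmetric] by simp
  qed
  ultimately have "distinct (all_ends (crossings (connected_sum K d K' d')))"
    using K(1) K'(1) unfolding sum closed_up_def
    by (simp only: shadow.sel map_append concat_append all_ends_map distinct_append distinct_map
        set_map) (meson inj_on_subset subset_UNIV)
  moreover have "finite (arcs (connected_sum K d K' d'))"
    using K K' by (simp add: sum closed_up_def)
  moreover have "fst e \<in> arcs (connected_sum K d K' d') \<and>
      opp e \<in> in_left ` crossing_ends K \<union> in_right ` crossing_ends K'"
    if "e \<in> in_left ` crossing_ends K \<union> in_right ` crossing_ends K'" for e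
    using that K(1) K'(1)
    by (auto simp: sum closed_up_def opp_in_left opp_in_right) (auto simp: in_left_def in_right_def)
  ultimately show ?closed
    unfolding closed_up_def[of "connected_sum K d K' d'"] \<open>?ends\<close> by blast
qed

text \<open>
  In the sum, the end \<open>opp d\<close> lies on the right cut arc and \<open>d'\<close> on the left one. By
  \<open>cut_arc_halves_connected\<close> these two arcs are connected through the left crossings alone. Hence both ends may be
  moved back to their own arcs at the price of a bridge between the arcs, which turns the joins of
  the sum into those of the two separate states plus the bridge.
\<close>

lemma card_state_circles_connected_sum:
  assumes K: "closed_up K" "d \<in> crossing_ends K" and K': "closed_up K'" "d' \<in> crossing_ends K'"
    and S: "S \<in> states K"
  shows "Suc (card (state_circles (connected_sum K d K' d') (S @ S'))) =
    card (state_circles K S) + card (state_circles K' S')"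
proof -
  let ?C = "crossings K" and ?C' = "crossings K'"
  \<comment> \<open>\<open>f\<close> and \<open>f'\<close> rename the arcs of the summands; \<open>g\<close> and \<open>g'\<close> give the arc of the sum on which an
    end of \<open>K\<close> or \<open>K'\<close> lies.\<close>
  define f f' where "f = (\<lambda>a::nat. 2 * a)" and "f' = (\<lambda>a::nat. 2 * a + 1)"
  define g where "g = (\<lambda>x. if x = opp d then f' (fst d') else f (fst x))"
  define g' where "g' = (\<lambda>x. if x = d' then f (fst d) else f' (fst x))"
  define J J' where "J = joins (f \<circ> fst) S ?C" and "J' = joins (f' \<circ> fst) S' ?C'"
  let ?T = "joins g S ?C \<union> joins g' S' ?C'"
  let ?ab = "(f (fst d), f' (fst d'))"
  note sum = connected_sum_at_crossings[OF K(2) K'(2)]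
  have len: "length S = length ?C" using S by (simp add: states_def)
  have opp_d: "opp d \<in> crossing_ends K" "fst (opp d) = fst d"
    using K by (auto simp: closed_up_def opp_def)
  have g: "fst \<circ> (exchange d d' \<circ> in_left) = g" "fst \<circ> (exchange d d' \<circ> in_right) = g'"
    by (auto simp: fun_eq_iff exchange_def g_def g'_def f_def f'_def)
      (auto simp: in_left_def in_right_def opp_def)
  have circles: "state_circles (connected_sum K d K' d') (S @ S') =
      classes (f ` arcs K \<union> f' ` arcs K') ?T"
    using len unfolding state_circles_joins sum
    by (simp add: joins_append joins_map g f_def f'_def del: One_nat_def)
  have "(f' (fst d'), f (fst (opp d))) \<in> eqcl (joins g S ?C)"
    using len K(1) opp_d(1) closed_up_crossing_ends[OF K(1)]
    by (intro cut_arc_halves_connected[OF _ _ _ _ g_def, where B = "fst ` crossing_ends K"])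
      (auto simp: closed_up_def crossing_ends_all_ends)
  then have "(f' (fst d'), f (fst d)) \<in> eqcl ?T"
    using eqcl_mono[of "joins g S ?C" ?T] opp_d(2) by auto
  then have ab: "?ab \<in> eqcl ?T"
    by (rule eqcl_sym)
  have "eqcl ?T = eqcl (J \<union> J' \<union> {?ab})" (is "_ = eqcl ?U")
  proof (rule eqcl_eqI)
    have abU: "?ab \<in> eqcl ?U" by (simp add: eqcl_base)
    have "joins g S ?C \<subseteq> eqcl ?U"
      by (rule joins_relabel[of "f \<circ> fst"])
        (use abU in \<open>auto simp: J_def[symmetric] g_def opp_d intro: eqcl_base\<close>)
    moreover have "joins g' S' ?C' \<subseteq> eqcl ?U"
      by (rule joins_relabel[of "f' \<circ> fst"])
        (use eqcl_sym[OF abU] in \<open>auto simp: J'_def[symmetric] g'_def intro: eqcl_base\<close>)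
    ultimately show "?T \<subseteq> eqcl ?U" by simp
    have "J \<subseteq> eqcl ?T" unfolding J_def
      by (rule joins_relabel[of g]) (use eqcl_sym[OF ab] in \<open>auto simp: g_def opp_d intro: eqcl_base\<close>)
    moreover have "J' \<subseteq> eqcl ?T" unfolding J'_def
      by (rule joins_relabel[of g']) (use ab in \<open>auto simp: g'_def intro: eqcl_base\<close>)
    ultimately show "?U \<subseteq> eqcl ?T" using ab by simp
  qed
  then have "classes (f ` arcs K \<union> f' ` arcs K') ?T = classes (f ` arcs K \<union> f' ` arcs K') ?U"
    by (rule classes_cong)
  moreover have J: "J = map_prod f f ` joins fst S ?C" "J' = map_prod f' f' ` joins fst S' ?C'"
    by (simp_all add: J_def J'_def joins_image)
  moreover have "Suc (card (classes (f ` arcs K \<union> f' ` arcs K') ?U)) =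
      card (classes (f ` arcs K) J) + card (classes (f' ` arcs K') J')"
  proof (rule card_classes_bridge)
    show "J \<subseteq> f ` arcs K \<times> f ` arcs K" "J' \<subseteq> f' ` arcs K' \<times> f' ` arcs K'"
      using joins_subset_arcs[OF K(1), of S] joins_subset_arcs[OF K'(1), of S'] J by auto
    show "f ` arcs K \<inter> f' ` arcs K' = {}"
      by (auto simp: f_def f'_def) presburger
  qed (use K K' in \<open>auto simp: closed_up_def\<close>)
  moreover have "inj_on f (arcs K)" "inj_on f' (arcs K')"
    by (auto simp: inj_on_def f_def f'_def)
  ultimately show ?thesis
    using joins_subset_arcs[OF K(1), of S] joins_subset_arcs[OF K'(1), of S']
    unfolding circles unfolding state_circles_joins by (simp add: card_classes_image)
qed

theorem gen_poly_connected_sum: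
  assumes K: "closed_up K" "d \<in> crossing_ends K" and K': "closed_up K'" "d' \<in> crossing_ends K'"
  shows "[:0, 1:] * gen_poly (connected_sum K d K' d') = gen_poly K * gen_poly K'"
proof -
  let ?X = "[:0, 1:] :: int poly" and ?s = "connected_sum K d K' d'"
  have "bij_betw (\<lambda>(S, S'). S @ S') (states K \<times> states K') (states ?s)"
    by (rule bij_betw_byWitness[where f' = "\<lambda>S. (take (length (crossings K)) S, drop (length (crossings K)) S)"])
      (auto simp: states_def connected_sum_at_crossings[OF K(2) K'(2)])
  then have "?X * gen_poly ?s =
      (\<Sum>(S, S')\<in>states K \<times> states K'. ?X ^ Suc (card (state_circles ?s (S @ S'))))"
    by (simp add: gen_poly_def sum_distrib_left sum.reindex_bij_betw[symmetric] case_prod_unfold)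
  also have "\<dots> = (\<Sum>(S, S')\<in>states K \<times> states K'.
      ?X ^ card (state_circles K S) * ?X ^ card (state_circles K' S'))"
    by (intro sum.cong refl)
      (auto simp only: mem_Sigma_iff card_state_circles_connected_sum[OF K K'] power_add split: prod.splits)
  also have "\<dots> = gen_poly K * gen_poly K'"
    by (simp add: gen_poly_def sum_product sum.cartesian_product)
  finally show ?thesis .
qed


section \<open>The twist links\<close>

text \<open>
  The invariant of the row: both end arcs lie at crossings, so that summing on either side is
  never the degenerate case of a crossingless circle.
\<close>

fun proper_strip :: "strip \<Rightarrow> bool" where
  "proper_strip (K, l, r) \<longleftrightarrow> closed_up K \<and> l \<in> crossing_ends K \<and> r \<in> crossing_ends K"

lemma proper_strip_row_sum: "proper_strip s \<Longrightarrow> proper_strip t \<Longrightarrow> proper_strip (row_sum s t)"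
  by (cases s; cases t) (auto simp: closed_up_connected_sum crossing_ends_connected_sum)

lemma gen_poly_row_sum:
  assumes "proper_strip s" "proper_strip t"
  shows "[:0, 1:] * gen_poly (fst (row_sum s t)) = gen_poly (fst s) * gen_poly (fst t)"
  using assms by (cases s; cases t) (simp add: gen_poly_connected_sum del: mult_pCons_left)

lemma proper_strip_hopf_link: "proper_strip hopf_link"
  using is_shadow_closed_up[OF is_shadow_hopf_link]
  by (simp add: hopf_link_def crossing_ends_def)

lemma proper_strip_figure_eight: "proper_strip figure_eight"
  using is_shadow_closed_up[OF is_shadow_figure_eight]
  by (simp add: figure_eight_def crossing_ends_def)

lemma gen_poly_figure_eight: "gen_poly (fst figure_eight) = [:0, 1, 1:]"
proof -
  let ?K = "fst figure_eight"
  have "states ?K = {[False], [True]}"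
    by (auto simp: states_def figure_eight_def length_Suc_conv)
  moreover have "state_circles ?K [False] = set ` set [[1, 0]]"
    unfolding state_circles_def by (rule classes_eqI) (auto simp: figure_eight_def)
  moreover have "state_circles ?K [True] = set ` set [[0], [1]]"
    unfolding state_circles_def by (rule classes_eqI) (auto simp: figure_eight_def)
  ultimately show ?thesis
    by (simp add: gen_poly_def power2_eq_square)
qed

text \<open>
  Splitting both crossings alike gives two circles, splitting them differently gives one. In
  the latter case the four joins alternate in direction around the circle, so a single arc is
  linked to each of the others instead of following the joins in order.
\<close>

lemma gen_poly_hopf_link: "gen_poly (fst hopf_link) = [:0, 2, 2:]"
proof -
  let ?K = "fst hopf_link"
  have "states ?K = {[False, False], [False, True], [True, False], [True, True]}"
    by (auto simp: states_def hopf_link_def length_Suc_conv)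
  moreover have "state_circles ?K [False, False] = set ` set [[3, 0], [1, 2]]"
    unfolding state_circles_def by (rule classes_eqI) (auto simp: hopf_link_def)
  moreover have "state_circles ?K [False, True] = {arcs ?K}"
    unfolding state_circles_def
  proof (rule classes_singletonI)
    let ?R = "\<Union>(t, c)\<in>set (zip [False, True] (crossings ?K)). split_at t c"
    have R: "?R = {(3, 0), (2, 1), (2, 0), (3, 1)}" by (auto simp: hopf_link_def)
    have "(3, 0) \<in> eqcl ?R" "(3, 1) \<in> eqcl ?R" "(2, 0) \<in> eqcl ?R"
      unfolding R by (auto intro: eqcl_base)
    then show "(3, x) \<in> eqcl ?R" if "x \<in> arcs ?K" for x
      using that eqcl_trans[OF _ eqcl_sym, of 3 0 ?R 2] by (auto simp: hopf_link_def)
  qed (auto simp: hopf_link_def)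
  moreover have "state_circles ?K [True, False] = {arcs ?K}"
    unfolding state_circles_def
  proof (rule classes_singletonI)
    let ?R = "\<Union>(t, c)\<in>set (zip [True, False] (crossings ?K)). split_at t c"
    have R: "?R = {(0, 2), (1, 3), (1, 2), (0, 3)}" by (auto simp: hopf_link_def)
    have "(0, 2) \<in> eqcl ?R" "(0, 3) \<in> eqcl ?R" "(1, 2) \<in> eqcl ?R"
      unfolding R by (auto intro: eqcl_base)
    then show "(0, x) \<in> eqcl ?R" if "x \<in> arcs ?K" for x
      using that eqcl_trans[OF _ eqcl_sym, of 0 2 ?R 1] by (auto simp: hopf_link_def)
  qed (auto simp: hopf_link_def)
  moreover have "state_circles ?K [True, True] = set ` set [[0, 2], [1, 3]]"
    unfolding state_circles_def by (rule classes_eqI) (auto simp: hopf_link_def)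
  ultimately show ?thesis
    by (simp add: gen_poly_def power2_eq_square doubleton_eq_iff)
qed

lemma
  shows proper_strip_one_twist_link: "proper_strip one_twist_link"
    and gen_poly_one_twist_link: "gen_poly (fst one_twist_link) = [:0, 1:] * [:2, 4, 2:]"
proof -
  note p = proper_strip_hopf_link proper_strip_figure_eight
  show "proper_strip one_twist_link"
    unfolding one_twist_link_def using p by (rule proper_strip_row_sum)
  have "[:0, 1:] * gen_poly (fst one_twist_link) = [:0, 1:] * ([:0, 1:] * [:2, 4, 2:])"
    unfolding one_twist_link_def gen_poly_row_sum[OF p]
    by (simp add: gen_poly_hopf_link gen_poly_figure_eight)
  then show "gen_poly (fst one_twist_link) = [:0, 1:] * [:2, 4, 2:]"
    by (subst (asm) mult_cancel_left) simp
qed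

lemma
  shows proper_strip_twist_row: "proper_strip (twist_row n)"
    and gen_poly_twist_row: "gen_poly (fst (twist_row n)) = [:0, 1:] * [:2, 4, 2:] ^ Suc n"
proof -
  have "proper_strip (twist_row n) \<and>
    gen_poly (fst (twist_row n)) = [:0, 1:] * [:2, 4, 2:] ^ Suc n"
  proof (induction n)
    case 0
    show ?case
      by (simp only: twist_row.simps proper_strip_one_twist_link gen_poly_one_twist_link power_Suc
          power_0 mult_1_right simp_thms)
  next
    case (Suc n)
    have "[:0, 1:] * gen_poly (fst (twist_row (Suc n))) =
        [:0, 1:] * ([:0, 1:] * [:2, 4, 2:] ^ Suc (Suc n))"
      using Suc gen_poly_row_sum[OF _ proper_strip_one_twist_link, of "twist_row n"]
      by (simp only: twist_row.simps gen_poly_one_twist_link power_Suc mult_ac)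
    then have "gen_poly (fst (twist_row (Suc n))) = [:0, 1:] * [:2, 4, 2:] ^ Suc (Suc n)"
      by (subst (asm) mult_cancel_left) simp
    with Suc show ?case
      by (simp only: twist_row.simps proper_strip_row_sum proper_strip_one_twist_link simp_thms)
  qed
  then show "proper_strip (twist_row n)"
    and "gen_poly (fst (twist_row n)) = [:0, 1:] * [:2, 4, 2:] ^ Suc n" by blast+
qed

lemma gen_poly_unknot: "gen_poly unknot = [:0, 1:]"
proof -
  have "states unknot = {[]}" by (simp add: states_def unknot_def)
  moreover have "state_circles unknot [] = set ` set [[0]]"
    unfolding state_circles_def by (rule classes_eqI) (auto simp: unknot_def)
  ultimately show ?thesis by (simp add: gen_poly_def)
qed

theorem theorem30:
  shows "(\<forall>n\<ge>1. gen_poly (twist_link n) = [:2, 4, 2:] * gen_poly (twist_link (n - 1))) \<and>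
         (\<forall>n. gen_poly (twist_link n) = [:0, 1:] * [:2, 4, 2:] ^ n)"
proof -
  have closed: "gen_poly (twist_link n) = [:0, 1:] * [:2, 4, 2:] ^ n" for n
    by (cases n) (simp_all only: twist_link.simps gen_poly_unknot gen_poly_twist_row power_0 mult_1_right)
  have "gen_poly (twist_link n) = [:2, 4, 2:] * gen_poly (twist_link (n - 1))" if "n \<ge> 1" for n
  proof -
    have "[:2, 4, 2:] ^ n = ([:2, 4, 2:] :: int poly) * [:2, 4, 2:] ^ (n - 1)"
      using that by (metis power_minus_mult mult.commute zero_less_one order_less_le_trans)
    then show ?thesis unfolding closed by (simp only: mult_ac)
  qed
  with closed show ?thesis by blast
qed

end
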